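(* Let $K$ be a field of characteristic zero, let $A$ be a unital $K$-algebra, and let $\psi_1,\psi_2:A\to Q(K)$ be two injective homomorphisms, leading to faithful extensions $E_1$ and $E_2$ of $A$ by $M_\infty(K)$ (the pullback extensions along $\psi_1$ and $\psi_2$). Then $E_1$ and $E_2$ are equivalent if and only if there is some invertible matrix $U\in \mathrm{B}(K)$ such that $\psi_2(a)=\pi(U)^{-1}\,\psi_1(a)\,\pi(U)$ for all $a\in A$.
   Context: $\mathbb{Z}^+$ denotes the positive integers. All $K$-algebras (except $M_\infty(K)$) are unital, and homomorphisms between unital algebras are unital. $\mathrm{B}(K)$ is the $K$-algebra of $\mathbb{Z}^+\times\mathbb{Z}^+$ matrices over $K$ with only finitely many nonzero entries in each row and each column. $M_\infty(K)$ is the ideal of $\mathrm{B}(K)$ of matrices with only finitely many nonzero entries. $Q(K)=\mathrm{B}(K)/M_\infty(K)$, with quotient map $\pi:\mathrm{B}(K)\to Q(K)$. "Invertible in $\mathrm{B}(K)$" means being a unit of $\mathrm{B}(K)$. An extension of $A$ by $M_\infty(K)$ is a short exact sequence of algebras $0\to M_\infty(K)\xrightarrow{i}E\xrightarrow{p}A\to 0$. It is faithful if $I=i(M_\infty(K))$ is a faithful ideal of $E$, i.e. $aI=\{0\}$ implies $a=0$ and $Ib=\{0\}$ implies $b=0$. Given a homomorphism $\psi:A\to Q(K)$, the associated pullback extension is $E_\psi=\{(m,a)\in \mathrm{B}(K)\oplus A:\pi(m)=\psi(a)\}$ with $i:M_\infty(K)\to E_\psi$, $m\mapsto (m,0)$,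 and $p:E_\psi\to A$, $(m,a)\mapsto a$. Here $E_1=E_{\psi_1}$ and $E_2=E_{\psi_2}$. Two extensions $(E_1,i_1,p_1)$ and $(E_2,i_2,p_2)$ of $A$ by $M_\infty(K)$ are equivalent if there is an algebra isomorphism $\Phi:E_1\to E_2$ which restricts to an automorphism of $M_\infty(K)$ (that is, $\Phi\circ i_1=i_2\circ\alpha$ for some algebra automorphism $\alpha$ of $M_\infty(K)$) and satisfies $p_2\circ\Phi=p_1$. *)

theory Defs
  imports "HOL-Algebra.Algebra" "HOL-Algebra.Algebraic_Closure_Type"
begin

text \<open>
  The ground field is a type \<open>'k\<close>, turned into a HOL-Algebra field by
  \<^const>\<open>ring_of_type_algebra\<close> (carrier \<^const>\<open>UNIV\<close>); algebras over it are \<open>('k, _) module\<close> records.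
  The library locale \<^locale>\<open>algebra\<close> is about commutative algebras only, so associative,
  not necessarily commutative algebras are introduced here.
\<close>

locale unital_algebra =
  module "ring_of_type_algebra :: 'k::field ring" A + ring A
  for A :: "('k::field, 'a, 'm) module_scheme" (structure) +
  assumes smult_mult_left:
    "\<lbrakk>x \<in> carrier A; y \<in> carrier A\<rbrakk> \<Longrightarrow> (c \<odot> x) \<otimes> y = c \<odot> (x \<otimes> y)"
    and smult_mult_right:
    "\<lbrakk>x \<in> carrier A; y \<in> carrier A\<rbrakk> \<Longrightarrow> x \<otimes> (c \<odot> y) = c \<odot> (x \<otimes> y)"

text \<open>Homomorphisms of algebras: the first notion ignores units, the second is unital.\<close>

definition nonunital_alg_hom ::
    "('k::field, 'a, 'm) module_scheme \<Rightarrow> ('k, 'b, 'n) module_scheme \<Rightarrow> ('a \<Rightarrow> 'b) set" where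
  "nonunital_alg_hom A B =
     {f \<in> hom A B \<inter> hom (add_monoid A) (add_monoid B).
        \<forall>c. \<forall>x \<in> carrier A. f (c \<odot>\<^bsub>A\<^esub> x) = c \<odot>\<^bsub>B\<^esub> f x}"

definition unital_alg_hom ::
    "('k::field, 'a, 'm) module_scheme \<Rightarrow> ('k, 'b, 'n) module_scheme \<Rightarrow> ('a \<Rightarrow> 'b) set" where
  "unital_alg_hom A B =
     {f \<in> ring_hom A B. \<forall>c. \<forall>x \<in> carrier A. f (c \<odot>\<^bsub>A\<^esub> x) = c \<odot>\<^bsub>B\<^esub> f x}"


text \<open>
  Matrices over the positive integers; rows and columns are numbered from 0 instead of 1.
\<close>

type_synonym 'k inf_mat = "nat \<Rightarrow> nat \<Rightarrow> 'k"

text \<open>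
  In the product the sum ranges over the nonzero entries of a row of the left factor,
  a finite set for matrices in the carrier.
\<close>

definition B_alg :: "('k::field, 'k inf_mat) module" where
  "B_alg =
    \<lparr>carrier = {m. (\<forall>i. finite {j. m i j \<noteq> 0}) \<and> (\<forall>j. finite {i. m i j \<noteq> 0})},
     monoid.mult = (\<lambda>m n i j. \<Sum>k | m i k \<noteq> 0. m i k * n k j),
     one = (\<lambda>i j. if i = j then 1 else 0),
     ring.zero = (\<lambda>i j. 0),
     add = (\<lambda>m n i j. m i j + n i j),
     module.smult = (\<lambda>c m i j. c * m i j)\<rparr>"

text \<open>
  The \<open>one\<close> field inherited by \<open>M_inf\<close> lies outside its carrier; \<open>M_inf\<close> is a non-unital algebra.
\<close>

definition M_inf :: "('k::field, 'k inf_mat) module" where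
  "M_inf = B_alg\<lparr>carrier := {m. finite {(i, j). m i j \<noteq> 0}}\<rparr>"

definition Q_alg :: "('k::field, 'k inf_mat set) module" where
  "Q_alg = ring.extend (B_alg Quot carrier M_inf)
     (module.fields (\<lambda>c S. \<Union>x\<in>S. carrier M_inf +>\<^bsub>B_alg\<^esub> (c \<odot>\<^bsub>B_alg\<^esub> x)))"

definition Q_proj :: "'k::field inf_mat \<Rightarrow> 'k inf_mat set" where
  "Q_proj m = carrier M_inf +>\<^bsub>B_alg\<^esub> m"


definition extension ::
    "('k::field, 'a) module \<Rightarrow> ('k, 'e) module \<Rightarrow> ('k inf_mat \<Rightarrow> 'e) \<Rightarrow> ('e \<Rightarrow> 'a) \<Rightarrow> bool" where
  "extension A E i p \<longleftrightarrow>
     unital_algebra A \<and> unital_algebra E \<and>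
     i \<in> nonunital_alg_hom M_inf E \<and> p \<in> unital_alg_hom E A \<and>
     inj_on i (carrier M_inf) \<and> i ` carrier M_inf = a_kernel E A p \<and>
     p ` carrier E = carrier A"

definition faithful_ideal :: "'e set \<Rightarrow> ('k::field, 'e) module \<Rightarrow> bool" where
  "faithful_ideal I E \<longleftrightarrow> ideal I E \<and>
     (\<forall>a \<in> carrier E. (\<forall>x \<in> I. a \<otimes>\<^bsub>E\<^esub> x = \<zero>\<^bsub>E\<^esub>) \<longrightarrow> a = \<zero>\<^bsub>E\<^esub>) \<and>
     (\<forall>b \<in> carrier E. (\<forall>x \<in> I. x \<otimes>\<^bsub>E\<^esub> b = \<zero>\<^bsub>E\<^esub>) \<longrightarrow> b = \<zero>\<^bsub>E\<^esub>)"

definition faithful_extension ::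
    "('k::field, 'a) module \<Rightarrow> ('k, 'e) module \<Rightarrow> ('k inf_mat \<Rightarrow> 'e) \<Rightarrow> ('e \<Rightarrow> 'a) \<Rightarrow> bool" where
  "faithful_extension A E i p \<longleftrightarrow>
     extension A E i p \<and> faithful_ideal (i ` carrier M_inf) E"

definition equivalent_extensions ::
    "('k::field, 'e) module \<Rightarrow> ('k inf_mat \<Rightarrow> 'e) \<Rightarrow> ('e \<Rightarrow> 'a) \<Rightarrow>
     ('k, 'f) module \<Rightarrow> ('k inf_mat \<Rightarrow> 'f) \<Rightarrow> ('f \<Rightarrow> 'a) \<Rightarrow> bool" where
  "equivalent_extensions E\<^sub>1 i\<^sub>1 p\<^sub>1 E\<^sub>2 i\<^sub>2 p\<^sub>2 \<longleftrightarrow>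
     (\<exists>\<Phi> \<in> unital_alg_hom E\<^sub>1 E\<^sub>2.
        bij_betw \<Phi> (carrier E\<^sub>1) (carrier E\<^sub>2) \<and>
        (\<exists>\<alpha> \<in> nonunital_alg_hom M_inf M_inf.
           bij_betw \<alpha> (carrier M_inf) (carrier M_inf) \<and>
           (\<forall>m \<in> carrier M_inf. \<Phi> (i\<^sub>1 m) = i\<^sub>2 (\<alpha> m))) \<and>
        (\<forall>x \<in> carrier E\<^sub>1. p\<^sub>2 (\<Phi> x) = p\<^sub>1 x))"


definition pullback_alg ::
    "('k::field, 'a) module \<Rightarrow> ('a \<Rightarrow> 'k inf_mat set) \<Rightarrow> ('k, 'k inf_mat \<times> 'a) module" where
  "pullback_alg A \<psi> =
    \<lparr>carrier = {(m, a). m \<in> carrier B_alg \<and> a \<in> carrier A \<and> Q_proj m = \<psi> a},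
     monoid.mult = (\<lambda>(m, a) (n, b). (m \<otimes>\<^bsub>B_alg\<^esub> n, a \<otimes>\<^bsub>A\<^esub> b)),
     one = (\<one>\<^bsub>B_alg\<^esub>, \<one>\<^bsub>A\<^esub>),
     ring.zero = (\<zero>\<^bsub>B_alg\<^esub>, \<zero>\<^bsub>A\<^esub>),
     add = (\<lambda>(m, a) (n, b). (m \<oplus>\<^bsub>B_alg\<^esub> n, a \<oplus>\<^bsub>A\<^esub> b)),
     module.smult = (\<lambda>c (m, a). (c \<odot>\<^bsub>B_alg\<^esub> m, c \<odot>\<^bsub>A\<^esub> a))\<rparr>"

definition pullback_incl :: "('k::field, 'a) module \<Rightarrow> 'k inf_mat \<Rightarrow> 'k inf_mat \<times> 'a" where
  "pullback_incl A m = (m, \<zero>\<^bsub>A\<^esub>)"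

definition pullback_proj :: "'k inf_mat \<times> 'a \<Rightarrow> 'a" where
  "pullback_proj = snd"

end

theory Submission
  imports Defs
begin

text \<open>
  An equivalence of extensions restricts to an automorphism \<open>\<alpha>\<close> of the ideal of finite matrices,
  and every such automorphism is conjugation by a unit \<open>U\<close> of \<open>B_alg\<close>
  (\<open>M_inf_automorphism_inner\<close>). The unit is read off from the images of the matrix units: they
  are again a system of matrix units, built from rank-one idempotents, hence they come from
  a basis of finite columns together with a dual basis of finite rows, and these are the columns
  of \<open>inv U\<close> and the rows of \<open>U\<close>. Because \<open>\<alpha>\<close> is onto, \<open>U\<close> and its inverse are both row-
  and column-finite.

  Now let \<open>\<Phi>\<close> be an equivalence of the two pullbacks. Since \<open>\<Phi>\<close> is multiplicative and the
  ideal is faithful, \<open>\<Phi>\<close> is determined by \<open>\<alpha>\<close>: it conjugates the matrix part of a pair by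
  \<open>U\<close> and keeps the algebra part (\<open>equivalent_imp_conjugate\<close>). That the resulting pair lies in
  the second pullback says exactly that \<open>\<psi>\<^sub>2 a\<close> is the conjugate of \<open>\<psi>\<^sub>1 a\<close> by the class of
  \<open>U\<close>. Conversely, if this conjugacy holds, conjugating matrix parts by \<open>U\<close> maps one pullback
  isomorphically onto the other (\<open>conjugate_imp_equivalent\<close>).

  Faithfulness of the extensions combines two facts: a matrix which annihilates all matrix units
  is zero, and a pair in the pullback along an injective map is zero once its matrix part is
  (\<open>pullback_faithful_extension\<close>).
\<close>

section \<open>The algebra of row- and column-finite matrices\<close>

lemma B_alg_simps:
  "m \<in> carrier B_alg \<longleftrightarrow> (\<forall>i. finite {j. m i j \<noteq> 0}) \<and> (\<forall>j. finite {i. m i j \<noteq> 0})"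
  "(m \<oplus>\<^bsub>B_alg\<^esub> n) i j = m i j + n i j"
  "(c \<odot>\<^bsub>B_alg\<^esub> m) i j = c * m i j"
  "\<zero>\<^bsub>B_alg\<^esub> i j = 0"
  "\<one>\<^bsub>B_alg\<^esub> i j = (if i = j then 1 else 0)"
  by (simp_all add: B_alg_def)

lemma M_inf_simps:
  "m \<in> carrier M_inf \<longleftrightarrow> finite {(i, j). m i j \<noteq> 0}"
  "m \<otimes>\<^bsub>M_inf\<^esub> n = m \<otimes>\<^bsub>B_alg\<^esub> n"
  "m \<oplus>\<^bsub>M_inf\<^esub> n = m \<oplus>\<^bsub>B_alg\<^esub> n"
  "c \<odot>\<^bsub>M_inf\<^esub> m = c \<odot>\<^bsub>B_alg\<^esub> m"
  by (simp_all add: M_inf_def B_alg_def)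

lemma B_mult: "(m \<otimes>\<^bsub>B_alg\<^esub> n) i j = (\<Sum>k | m i k \<noteq> 0. m i k * n k j)"
  by (simp add: B_alg_def)

text \<open>
  The product sums over the support of a row of the left factor. Replacing that set by a common
  finite superset is what makes products with different left factors comparable.
\<close>

lemma B_mult_superset:
  assumes "finite S" "{k. m i k \<noteq> 0} \<subseteq> S"
  shows "(m \<otimes>\<^bsub>B_alg\<^esub> n) i j = (\<Sum>k\<in>S. m i k * n k j)"
  unfolding B_mult using assms by (intro sum.mono_neutral_left) auto

lemma B_mult_nonzero:
  assumes "(m \<otimes>\<^bsub>B_alg\<^esub> n) i j \<noteq> 0"
  obtains k where "m i k \<noteq> 0" "n k j \<noteq> 0"
proof -
  from assms obtain k where "m i k * n k j \<noteq> 0"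
    unfolding B_mult by (meson sum.neutral)
  then show thesis using that[of k] by auto
qed

lemma B_mult_closed:
  assumes "m \<in> carrier B_alg" "n \<in> carrier B_alg"
  shows "m \<otimes>\<^bsub>B_alg\<^esub> n \<in> carrier B_alg"
  unfolding B_alg_simps(1)
proof (intro conjI allI)
  fix i
  have "{j. (m \<otimes>\<^bsub>B_alg\<^esub> n) i j \<noteq> 0} \<subseteq> (\<Union>k\<in>{k. m i k \<noteq> 0}. {j. n k j \<noteq> 0})"
    by (auto elim: B_mult_nonzero)
  then show "finite {j. (m \<otimes>\<^bsub>B_alg\<^esub> n) i j \<noteq> 0}"
    by (rule finite_subset) (use assms in \<open>simp add: B_alg_simps\<close>)
next
  fix j
  have "{i. (m \<otimes>\<^bsub>B_alg\<^esub> n) i j \<noteq> 0} \<subseteq> (\<Union>k\<in>{k. n k j \<noteq> 0}. {i. m i k \<noteq> 0})"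
    by (auto elim: B_mult_nonzero)
  then show "finite {i. (m \<otimes>\<^bsub>B_alg\<^esub> n) i j \<noteq> 0}"
    by (rule finite_subset) (use assms in \<open>simp add: B_alg_simps\<close>)
qed

lemma B_add_closed:
  assumes "m \<in> carrier B_alg" "n \<in> carrier B_alg"
  shows "m \<oplus>\<^bsub>B_alg\<^esub> n \<in> carrier B_alg"
proof -
  have "{j. m i j + n i j \<noteq> 0} \<subseteq> {j. m i j \<noteq> 0} \<union> {j. n i j \<noteq> 0}"
    "{i. m i j + n i j \<noteq> 0} \<subseteq> {i. m i j \<noteq> 0} \<union> {i. n i j \<noteq> 0}" for i j
    by auto
  then show ?thesis
    using assms by (simp add: B_alg_simps) (meson finite_Un finite_subset)
qed

lemma B_smult_closed:
  "m \<in> carrier B_alg \<Longrightarrow> c \<odot>\<^bsub>B_alg\<^esub> m \<in> carrier B_alg"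
  by (cases "c = 0") (simp_all add: B_alg_simps)

lemma B_mult_assoc:
  assumes m: "m \<in> carrier B_alg" and n: "n \<in> carrier B_alg"
  shows "m \<otimes>\<^bsub>B_alg\<^esub> n \<otimes>\<^bsub>B_alg\<^esub> r = m \<otimes>\<^bsub>B_alg\<^esub> (n \<otimes>\<^bsub>B_alg\<^esub> r)"
proof (intro ext)
  fix i j
  define S where "S = {k. m i k \<noteq> 0}"
  define T where "T = (\<Union>k\<in>S. {l. n k l \<noteq> 0})"
  have S: "finite S" and T: "finite T"
    using m n by (auto simp: S_def T_def B_alg_simps)
  have "(m \<otimes>\<^bsub>B_alg\<^esub> n \<otimes>\<^bsub>B_alg\<^esub> r) i j = (\<Sum>l\<in>T. (m \<otimes>\<^bsub>B_alg\<^esub> n) i l * r l j)"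
    by (rule B_mult_superset[OF T]) (auto simp: S_def T_def elim: B_mult_nonzero)
  also have "\<dots> = (\<Sum>l\<in>T. \<Sum>k\<in>S. m i k * n k l * r l j)"
    by (simp add: B_mult S_def sum_distrib_right)
  also have "\<dots> = (\<Sum>k\<in>S. m i k * (\<Sum>l\<in>T. n k l * r l j))"
    by (subst sum.swap) (simp add: sum_distrib_left mult.assoc)
  also have "\<dots> = (\<Sum>k\<in>S. m i k * (n \<otimes>\<^bsub>B_alg\<^esub> r) k j)"
  proof (intro sum.cong refl)
    fix k assume "k \<in> S"
    then show "m i k * (\<Sum>l\<in>T. n k l * r l j) = m i k * (n \<otimes>\<^bsub>B_alg\<^esub> r) k j"
      by (subst B_mult_superset[OF T]) (auto simp: T_def)
  qed
  also have "\<dots> = (m \<otimes>\<^bsub>B_alg\<^esub> (n \<otimes>\<^bsub>B_alg\<^esub> r)) i j"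
    by (simp add: B_mult S_def)
  finally show "(m \<otimes>\<^bsub>B_alg\<^esub> n \<otimes>\<^bsub>B_alg\<^esub> r) i j = (m \<otimes>\<^bsub>B_alg\<^esub> (n \<otimes>\<^bsub>B_alg\<^esub> r)) i j" .
qed

lemma B_distrib_right:
  assumes m: "m \<in> carrier B_alg" and n: "n \<in> carrier B_alg"
  shows "(m \<oplus>\<^bsub>B_alg\<^esub> n) \<otimes>\<^bsub>B_alg\<^esub> r = m \<otimes>\<^bsub>B_alg\<^esub> r \<oplus>\<^bsub>B_alg\<^esub> n \<otimes>\<^bsub>B_alg\<^esub> r"
proof (intro ext)
  fix i j
  define S where "S = {k. m i k \<noteq> 0} \<union> {k. n i k \<noteq> 0}"
  have S: "finite S" using m n by (simp add: S_def B_alg_simps)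
  have eq: "(x \<otimes>\<^bsub>B_alg\<^esub> r) i j = (\<Sum>k\<in>S. x i k * r k j)" if "x \<in> {m, n, m \<oplus>\<^bsub>B_alg\<^esub> n}" for x
    using that by (intro B_mult_superset[OF S]) (auto simp: S_def B_alg_simps)
  show "((m \<oplus>\<^bsub>B_alg\<^esub> n) \<otimes>\<^bsub>B_alg\<^esub> r) i j = (m \<otimes>\<^bsub>B_alg\<^esub> r \<oplus>\<^bsub>B_alg\<^esub> n \<otimes>\<^bsub>B_alg\<^esub> r) i j"
    by (simp add: eq B_alg_simps distrib_right sum.distrib)
qed

lemma unital_algebraI:
  fixes A :: "('k::field, 'a, 'm) module_scheme" (structure)
  assumes "ring A"
    and "\<And>c x. x \<in> carrier A \<Longrightarrow> c \<odot> x \<in> carrier A"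
    and "\<And>b c x. x \<in> carrier A \<Longrightarrow> (b + c) \<odot> x = b \<odot> x \<oplus> c \<odot> x"
    and "\<And>c x y. \<lbrakk>x \<in> carrier A; y \<in> carrier A\<rbrakk> \<Longrightarrow> c \<odot> (x \<oplus> y) = c \<odot> x \<oplus> c \<odot> y"
    and "\<And>b c x. x \<in> carrier A \<Longrightarrow> (b * c) \<odot> x = b \<odot> (c \<odot> x)"
    and "\<And>x. x \<in> carrier A \<Longrightarrow> 1 \<odot> x = x"
    and "\<And>c x y. \<lbrakk>x \<in> carrier A; y \<in> carrier A\<rbrakk> \<Longrightarrow> (c \<odot> x) \<otimes> y = c \<odot> (x \<otimes> y)"
    and "\<And>c x y. \<lbrakk>x \<in> carrier A; y \<in> carrier A\<rbrakk> \<Longrightarrow> x \<otimes> (c \<odot> y) = c \<odot> (x \<otimes> y)"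
  shows "unital_algebra A"
proof -
  interpret A: ring A by fact
  show ?thesis
    by (intro unital_algebra.intro unital_algebra_axioms.intro moduleI cring_from_type_algebra
          A.abelian_group_axioms A.ring_axioms)
      (simp_all add: assms ring_of_type_algebra_def)
qed

lemma (in unital_algebra) scalar_laws:
  assumes "x \<in> carrier A"
  shows "c \<odot> x \<in> carrier A"
    and "(b + c) \<odot> x = b \<odot> x \<oplus> c \<odot> x"
    and "y \<in> carrier A \<Longrightarrow> c \<odot> (x \<oplus> y) = c \<odot> x \<oplus> c \<odot> y"
    and "(b * c) \<odot> x = b \<odot> (c \<odot> x)"
    and "1 \<odot> x = x"
  using assms smult_closed[of c x] smult_l_distr[of b c x] smult_r_distr[of c x y]
    smult_assoc1[of b c x] smult_one[of x]
  by (simp_all add: ring_of_type_algebra_def)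

lemma (in unital_algebra) smult_zero: "c \<odot> \<zero> = \<zero>"
  using smult_r_null[of c] by (simp add: ring_of_type_algebra_def)

lemma unital_algebra_B: "unital_algebra (B_alg :: ('k::field, 'k inf_mat) module)"
proof (rule unital_algebraI)
  have "abelian_group (B_alg :: ('k, 'k inf_mat) module)"
  proof (rule abelian_groupI)
    fix m :: "'k inf_mat" assume "m \<in> carrier B_alg"
    then show "\<exists>n\<in>carrier B_alg. n \<oplus>\<^bsub>B_alg\<^esub> m = \<zero>\<^bsub>B_alg\<^esub>"
      by (intro bexI[of _ "-1 \<odot>\<^bsub>B_alg\<^esub> m"] B_smult_closed ext) (simp_all add: B_alg_simps)
  qed (simp_all add: B_add_closed, auto simp: B_alg_simps fun_eq_iff)
  moreover have "Group.monoid (B_alg :: ('k, 'k inf_mat) module)"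
  proof (rule monoidI)
    fix m :: "'k inf_mat" assume m: "m \<in> carrier B_alg"
    show "\<one>\<^bsub>B_alg\<^esub> \<otimes>\<^bsub>B_alg\<^esub> m = m"
    proof (intro ext)
      fix i j
      show "(\<one>\<^bsub>B_alg\<^esub> \<otimes>\<^bsub>B_alg\<^esub> m) i j = m i j"
        by (subst B_mult_superset[where S = "{i}"]) (auto simp: B_alg_simps)
    qed
    show "m \<otimes>\<^bsub>B_alg\<^esub> \<one>\<^bsub>B_alg\<^esub> = m"
      using m by (auto simp: B_mult B_alg_simps fun_eq_iff if_distrib[of "(*) _"] sum.delta' cong: if_cong)
  qed (simp_all add: B_mult_closed B_mult_assoc, simp add: B_alg_simps)
  moreover have "m \<otimes>\<^bsub>B_alg\<^esub> (n \<oplus>\<^bsub>B_alg\<^esub> r) = m \<otimes>\<^bsub>B_alg\<^esub> n \<oplus>\<^bsub>B_alg\<^esub> m \<otimes>\<^bsub>B_alg\<^esub> r"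
    for m n r :: "'k inf_mat"
    by (simp add: fun_eq_iff B_mult B_alg_simps distrib_left sum.distrib)
  ultimately show "ring (B_alg :: ('k, 'k inf_mat) module)"
    by (intro ringI B_distrib_right)
next
  fix c :: 'k and m n :: "'k inf_mat"
  show "(c \<odot>\<^bsub>B_alg\<^esub> m) \<otimes>\<^bsub>B_alg\<^esub> n = c \<odot>\<^bsub>B_alg\<^esub> (m \<otimes>\<^bsub>B_alg\<^esub> n)"
    by (cases "c = 0") (simp_all add: fun_eq_iff B_mult B_alg_simps sum_distrib_left mult.assoc)
  show "m \<otimes>\<^bsub>B_alg\<^esub> (c \<odot>\<^bsub>B_alg\<^esub> n) = c \<odot>\<^bsub>B_alg\<^esub> (m \<otimes>\<^bsub>B_alg\<^esub> n)"
    by (simp add: fun_eq_iff B_mult B_alg_simps sum_distrib_left mult.left_commute)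
qed (simp_all add: B_smult_closed, simp_all add: fun_eq_iff B_alg_simps algebra_simps)

interpretation B: unital_algebra B_alg
  by (rule unital_algebra_B)


section \<open>Matrix units and the ideal of finite matrices\<close>

definition mat_unit :: "nat \<Rightarrow> nat \<Rightarrow> 'k::field inf_mat" where
  "mat_unit k l = (\<lambda>i j. if i = k \<and> j = l then 1 else 0)"

lemma M_inf_subset: "carrier M_inf \<subseteq> (carrier B_alg :: 'k::field inf_mat set)"
proof
  fix m :: "'k inf_mat" assume m: "m \<in> carrier M_inf"
  have "{j. m i j \<noteq> 0} \<subseteq> snd ` {(i, j). m i j \<noteq> 0}"
    "{i. m i j \<noteq> 0} \<subseteq> fst ` {(i, j). m i j \<noteq> 0}" for i j
    by force+
  then show "m \<in> carrier B_alg"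
    using m unfolding M_inf_simps B_alg_simps by (meson finite_imageI finite_subset)
qed

lemma M_inf_in_B: "m \<in> carrier M_inf \<Longrightarrow> m \<in> carrier B_alg"
  using M_inf_subset by blast

lemma M_inf_ideal: "ideal (carrier M_inf) (B_alg :: ('k::field, 'k inf_mat) module)"
proof (rule idealI)
  show "ring (B_alg :: ('k, 'k inf_mat) module)" by (rule B.ring_axioms)
  show "subgroup (carrier M_inf) (add_monoid (B_alg :: ('k, 'k inf_mat) module))"
  proof (rule B.add.subgroupI)
    fix m :: "'k inf_mat" assume m: "m \<in> carrier M_inf"
    have "-1 \<odot>\<^bsub>B_alg\<^esub> m \<oplus>\<^bsub>B_alg\<^esub> m = \<zero>\<^bsub>B_alg\<^esub>"
      by (simp add: fun_eq_iff B_alg_simps)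
    then have "\<ominus>\<^bsub>B_alg\<^esub> m = -1 \<odot>\<^bsub>B_alg\<^esub> m"
      using m by (intro B.minus_equality B_smult_closed M_inf_in_B)
    then show "\<ominus>\<^bsub>B_alg\<^esub> m \<in> carrier M_inf"
      using m by (simp add: M_inf_simps B_alg_simps)
    fix n :: "'k inf_mat" assume n: "n \<in> carrier M_inf"
    have "{(i, j). m i j + n i j \<noteq> 0} \<subseteq> {(i, j). m i j \<noteq> 0} \<union> {(i, j). n i j \<noteq> 0}"
      by auto
    then show "m \<oplus>\<^bsub>B_alg\<^esub> n \<in> carrier M_inf"
      using m n unfolding M_inf_simps B_alg_simps by (meson finite_UnI finite_subset)
  next
    have "\<zero>\<^bsub>B_alg\<^esub> \<in> carrier M_inf" by (simp add: M_inf_simps B_alg_simps)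
    then show "carrier M_inf \<noteq> ({} :: 'k inf_mat set)" by blast
  qed (rule M_inf_subset)
next
  fix m b :: "'k inf_mat" assume m: "m \<in> carrier M_inf" and b: "b \<in> carrier B_alg"
  let ?S = "{(i, j). m i j \<noteq> 0}"
  have "{(i, j). (m \<otimes>\<^bsub>B_alg\<^esub> b) i j \<noteq> 0} \<subseteq> (\<Union>(i, k)\<in>?S. {i} \<times> {j. b k j \<noteq> 0})"
    by (auto elim!: B_mult_nonzero)
  then show "m \<otimes>\<^bsub>B_alg\<^esub> b \<in> carrier M_inf"
    unfolding M_inf_simps
    by (rule finite_subset) (use m b in \<open>auto simp: M_inf_simps B_alg_simps\<close>)
  have "{(i, j). (b \<otimes>\<^bsub>B_alg\<^esub> m) i j \<noteq> 0} \<subseteq> (\<Union>(k, j)\<in>?S. {i. b i k \<noteq> 0} \<times> {j})"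
    by (auto elim!: B_mult_nonzero)
  then show "b \<otimes>\<^bsub>B_alg\<^esub> m \<in> carrier M_inf"
    unfolding M_inf_simps
    by (rule finite_subset) (use m b in \<open>auto simp: M_inf_simps B_alg_simps\<close>)
qed

lemma M_inf_closed:
  "\<zero>\<^bsub>B_alg\<^esub> \<in> carrier M_inf"
  "m \<in> carrier M_inf \<Longrightarrow> c \<odot>\<^bsub>B_alg\<^esub> m \<in> carrier M_inf"
  "(mat_unit k l :: 'k inf_mat) \<in> carrier M_inf"
  for m :: "'k::field inf_mat"
proof -
  show "\<zero>\<^bsub>B_alg\<^esub> \<in> carrier M_inf" by (simp add: M_inf_simps B_alg_simps)
  show "c \<odot>\<^bsub>B_alg\<^esub> m \<in> carrier M_inf" if "m \<in> carrier M_inf"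
    using that by (cases "c = 0") (simp_all add: M_inf_simps B_alg_simps)
  have "{(i, j). (mat_unit k l :: 'k inf_mat) i j \<noteq> 0} = {(k, l)}"
    by (auto simp: mat_unit_def)
  then show "(mat_unit k l :: 'k inf_mat) \<in> carrier M_inf"
    by (simp add: M_inf_simps)
qed

lemma mat_unit_in_B: "mat_unit k l \<in> carrier B_alg"
  by (rule M_inf_in_B[OF M_inf_closed(3)])

lemma mult_mat_unit:
  assumes "m \<in> carrier B_alg"
  shows "(m \<otimes>\<^bsub>B_alg\<^esub> mat_unit k l) i j = (if j = l then m i k else 0)"
proof -
  have "(m \<otimes>\<^bsub>B_alg\<^esub> mat_unit k l) i j = (\<Sum>r\<in>insert k {r. m i r \<noteq> 0}. m i r * mat_unit k l r j)"
    using assms by (intro B_mult_superset) (auto simp: B_alg_simps)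
  also have "\<dots> = (\<Sum>r\<in>{k}. m i r * mat_unit k l r j)"
    using assms by (intro sum.mono_neutral_right) (auto simp: mat_unit_def B_alg_simps)
  finally show ?thesis by (simp add: mat_unit_def)
qed

lemma mat_unit_mult: "(mat_unit k l \<otimes>\<^bsub>B_alg\<^esub> m) i j = (if i = k then m l j else 0)"
  by (subst B_mult_superset[where S = "{l}"]) (auto simp: mat_unit_def)

lemma mat_unit_mat_unit:
  "mat_unit k l \<otimes>\<^bsub>B_alg\<^esub> mat_unit r s =
     (if l = r then mat_unit k s else \<zero>\<^bsub>B_alg\<^esub>)"
  by (auto simp: fun_eq_iff mat_unit_mult B_alg_simps) (auto simp: mat_unit_def)

text \<open>Multiplication by the diagonal matrix unit \<open>k\<close> on the right isolates column \<open>k\<close>.\<close>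

lemma eq_if_mult_mat_units_eq:
  assumes "m \<in> carrier B_alg" "n \<in> carrier B_alg"
    and "\<And>k. m \<otimes>\<^bsub>B_alg\<^esub> mat_unit k k = n \<otimes>\<^bsub>B_alg\<^esub> mat_unit k k"
  shows "m = n"
proof (intro ext)
  fix i k
  show "m i k = n i k"
    using fun_cong[OF fun_cong[OF assms(3)[of k], of i], of k] assms(1,2)
    by (simp add: mult_mat_unit)
qed

lemma M_inf_annihilators:
  assumes "m \<in> carrier B_alg"
  shows "(\<And>x. x \<in> carrier M_inf \<Longrightarrow> m \<otimes>\<^bsub>B_alg\<^esub> x = \<zero>\<^bsub>B_alg\<^esub>) \<Longrightarrow> m = \<zero>\<^bsub>B_alg\<^esub>"
    and "(\<And>x. x \<in> carrier M_inf \<Longrightarrow> x \<otimes>\<^bsub>B_alg\<^esub> m = \<zero>\<^bsub>B_alg\<^esub>) \<Longrightarrow> m = \<zero>\<^bsub>B_alg\<^esub>"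
proof -
  assume *: "\<And>x. x \<in> carrier M_inf \<Longrightarrow> m \<otimes>\<^bsub>B_alg\<^esub> x = \<zero>\<^bsub>B_alg\<^esub>"
  show "m = \<zero>\<^bsub>B_alg\<^esub>"
    by (rule eq_if_mult_mat_units_eq) (simp_all add: assms * M_inf_closed mat_unit_in_B)
next
  assume *: "\<And>x. x \<in> carrier M_inf \<Longrightarrow> x \<otimes>\<^bsub>B_alg\<^esub> m = \<zero>\<^bsub>B_alg\<^esub>"
  show "m = \<zero>\<^bsub>B_alg\<^esub>"
  proof (intro ext)
    fix i j
    show "m i j = \<zero>\<^bsub>B_alg\<^esub> i j"
      using fun_cong[OF fun_cong[OF *[OF M_inf_closed(3)[of i i]], of i], of j]
      by (simp add: mat_unit_mult B_alg_simps)
  qed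
qed


section \<open>The quotient algebra\<close>

lemma Q_alg_simps:
  "carrier Q_alg = carrier (B_alg Quot carrier M_inf)"
  "x \<otimes>\<^bsub>Q_alg\<^esub> y = x \<otimes>\<^bsub>B_alg Quot carrier M_inf\<^esub> y"
  "x \<oplus>\<^bsub>Q_alg\<^esub> y = x \<oplus>\<^bsub>B_alg Quot carrier M_inf\<^esub> y"
  "\<one>\<^bsub>Q_alg\<^esub> = \<one>\<^bsub>B_alg Quot carrier M_inf\<^esub>"
  "\<zero>\<^bsub>Q_alg\<^esub> = \<zero>\<^bsub>B_alg Quot carrier M_inf\<^esub>"
  "c \<odot>\<^bsub>Q_alg\<^esub> x = (\<Union>m\<in>x. Q_proj (c \<odot>\<^bsub>B_alg\<^esub> m))"
  by (simp_all add: Q_alg_def Q_proj_def ring.defs module.defs)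

lemma ring_Q: "ring (Q_alg :: ('k::field, 'k inf_mat set) module)"
proof -
  interpret Q: ring "B_alg Quot carrier M_inf :: 'k inf_mat set ring"
    by (rule ideal.quotient_is_ring[OF M_inf_ideal])
  have "abelian_group (Q_alg :: ('k, 'k inf_mat set) module)"
  proof (rule abelian_groupI)
    fix x :: "'k inf_mat set" assume "x \<in> carrier Q_alg"
    then show "\<exists>y\<in>carrier Q_alg. y \<oplus>\<^bsub>Q_alg\<^esub> x = \<zero>\<^bsub>Q_alg\<^esub>"
      using Q.l_neg[of x] Q.a_inv_closed[of x] by (auto simp: Q_alg_simps)
  qed (simp_all add: Q_alg_simps Q.a_ac)
  moreover have "Group.monoid (Q_alg :: ('k, 'k inf_mat set) module)"
    by (rule monoidI) (simp_all add: Q_alg_simps Q.m_assoc)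
  ultimately show ?thesis
    by (rule ringI) (simp_all add: Q_alg_simps Q.l_distr Q.r_distr)
qed

interpretation Q: ring Q_alg
  by (rule ring_Q)

lemma Q_proj_ring_hom: "Q_proj \<in> ring_hom B_alg (Q_alg :: ('k::field, 'k inf_mat set) module)"
  using ideal.rcos_ring_hom[OF M_inf_ideal]
  by (simp add: ring_hom_def Q_alg_simps Q_proj_def[abs_def])

lemma ring_hom_laws:
  fixes R (structure) and S (structure)
  assumes "ring R" "ring S" "h \<in> ring_hom R S"
  shows "x \<in> carrier R \<Longrightarrow> h x \<in> carrier S"
    and "\<lbrakk>x \<in> carrier R; y \<in> carrier R\<rbrakk> \<Longrightarrow> h (x \<otimes> y) = h x \<otimes>\<^bsub>S\<^esub> h y"
    and "\<lbrakk>x \<in> carrier R; y \<in> carrier R\<rbrakk> \<Longrightarrow> h (x \<oplus> y) = h x \<oplus>\<^bsub>S\<^esub> h y"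
    and "h \<one> = \<one>\<^bsub>S\<^esub>" "h \<zero> = \<zero>\<^bsub>S\<^esub>"
    and "x \<in> carrier R \<Longrightarrow> h (\<ominus> x) = \<ominus>\<^bsub>S\<^esub> h x"
proof -
  interpret ring_hom_ring R S h
    by (intro ring_hom_ringI2 assms)
  show "x \<in> carrier R \<Longrightarrow> h x \<in> carrier S"
    "\<lbrakk>x \<in> carrier R; y \<in> carrier R\<rbrakk> \<Longrightarrow> h (x \<otimes> y) = h x \<otimes>\<^bsub>S\<^esub> h y"
    "\<lbrakk>x \<in> carrier R; y \<in> carrier R\<rbrakk> \<Longrightarrow> h (x \<oplus> y) = h x \<oplus>\<^bsub>S\<^esub> h y"
    "h \<one> = \<one>\<^bsub>S\<^esub>" "h \<zero> = \<zero>\<^bsub>S\<^esub>"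
    "x \<in> carrier R \<Longrightarrow> h (\<ominus> x) = \<ominus>\<^bsub>S\<^esub> h x"
    by simp_all
qed

lemmas Q_proj_hom [simp] = ring_hom_laws[OF B.ring_axioms ring_Q Q_proj_ring_hom]

lemma Q_proj_eq_zero_iff:
  assumes "m \<in> carrier B_alg"
  shows "Q_proj m = \<zero>\<^bsub>Q_alg\<^esub> \<longleftrightarrow> m \<in> carrier M_inf"
proof -
  interpret additive_subgroup "carrier M_inf" "B_alg :: ('a, 'a inf_mat) module"
    by (rule ideal.axioms(1)[OF M_inf_ideal])
  interpret abelian_subgroup "carrier M_inf" "B_alg :: ('a, 'a inf_mat) module"
    by (rule abelian_subgroupI3) (unfold_locales)
  show ?thesis
    using assms a_rcos_const B.a_coset_join1[OF _ _ a_subgroup]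
    by (auto simp: Q_alg_simps Q_proj_def FactRing_def)
qed

lemma Q_alg_carrier_eq: "carrier Q_alg = Q_proj ` carrier B_alg"
  by (auto simp: Q_alg_simps FactRing_def A_RCOSETS_def' Q_proj_def)

text \<open>
  Scalar multiplication in the quotient is the union, over the representatives of a coset, of the
  cosets of their multiples. It is a single coset because two representatives differ by an element
  of the ideal, which is closed under scalars.
\<close>

lemma Q_proj_smult:
  assumes m: "m \<in> carrier B_alg"
  shows "Q_proj (c \<odot>\<^bsub>B_alg\<^esub> m) = c \<odot>\<^bsub>Q_alg\<^esub> Q_proj m"
proof -
  have "Q_proj (c \<odot>\<^bsub>B_alg\<^esub> x) = Q_proj (c \<odot>\<^bsub>B_alg\<^esub> m)" if x: "x \<in> Q_proj m" for x
  proof -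
    from x obtain h where h: "h \<in> carrier M_inf" "x = h \<oplus>\<^bsub>B_alg\<^esub> m"
      by (auto simp: Q_proj_def a_r_coset_def')
    then have hB: "h \<in> carrier B_alg" by (intro M_inf_in_B)
    have "Q_proj (c \<odot>\<^bsub>B_alg\<^esub> h) = \<zero>\<^bsub>Q_alg\<^esub>"
      using hB h by (simp add: Q_proj_eq_zero_iff M_inf_closed B_smult_closed)
    then show ?thesis
      using hB m by (simp add: h(2) B.scalar_laws(3) B_smult_closed)
  qed
  moreover have "m \<in> Q_proj m"
    using m M_inf_closed(1) B.l_zero[of m] by (force simp: Q_proj_def a_r_coset_def')
  ultimately show ?thesis
    unfolding Q_alg_simps by blast
qed

lemma Q_proj_conjugate:
  assumes U: "U \<in> Units B_alg" and m: "m \<in> carrier B_alg"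
  shows "Q_proj U \<in> Units Q_alg"
    and "Q_proj (inv\<^bsub>B_alg\<^esub> U) = inv\<^bsub>Q_alg\<^esub> Q_proj U"
    and "Q_proj (inv\<^bsub>B_alg\<^esub> U \<otimes>\<^bsub>B_alg\<^esub> m \<otimes>\<^bsub>B_alg\<^esub> U) =
      inv\<^bsub>Q_alg\<^esub> Q_proj U \<otimes>\<^bsub>Q_alg\<^esub> Q_proj m \<otimes>\<^bsub>Q_alg\<^esub> Q_proj U"
proof -
  have V: "Q_proj U \<otimes>\<^bsub>Q_alg\<^esub> Q_proj (inv\<^bsub>B_alg\<^esub> U) = \<one>\<^bsub>Q_alg\<^esub>"
    "Q_proj (inv\<^bsub>B_alg\<^esub> U) \<otimes>\<^bsub>Q_alg\<^esub> Q_proj U = \<one>\<^bsub>Q_alg\<^esub>"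
    using U by (simp_all add: B.Units_closed flip: Q_proj_hom(2))
  moreover have "Q_proj U \<in> carrier Q_alg" "Q_proj (inv\<^bsub>B_alg\<^esub> U) \<in> carrier Q_alg"
    using U by (simp_all add: B.Units_closed)
  ultimately show "Q_proj U \<in> Units Q_alg"
    unfolding Units_def by blast
  show inv: "Q_proj (inv\<^bsub>B_alg\<^esub> U) = inv\<^bsub>Q_alg\<^esub> Q_proj U"
    using U V by (intro Q.inv_unique') (simp_all add: B.Units_closed)
  show "Q_proj (inv\<^bsub>B_alg\<^esub> U \<otimes>\<^bsub>B_alg\<^esub> m \<otimes>\<^bsub>B_alg\<^esub> U) =
      inv\<^bsub>Q_alg\<^esub> Q_proj U \<otimes>\<^bsub>Q_alg\<^esub> Q_proj m \<otimes>\<^bsub>Q_alg\<^esub> Q_proj U"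
    using U m by (simp add: inv[symmetric] B.Units_closed)
qed


section \<open>Pullback extensions\<close>

lemma pullback_simps:
  "x \<in> carrier (pullback_alg A \<psi>) \<longleftrightarrow>
     fst x \<in> carrier B_alg \<and> snd x \<in> carrier A \<and> Q_proj (fst x) = \<psi> (snd x)"
  "x \<otimes>\<^bsub>pullback_alg A \<psi>\<^esub> y = (fst x \<otimes>\<^bsub>B_alg\<^esub> fst y, snd x \<otimes>\<^bsub>A\<^esub> snd y)"
  "x \<oplus>\<^bsub>pullback_alg A \<psi>\<^esub> y = (fst x \<oplus>\<^bsub>B_alg\<^esub> fst y, snd x \<oplus>\<^bsub>A\<^esub> snd y)"
  "c \<odot>\<^bsub>pullback_alg A \<psi>\<^esub> x = (c \<odot>\<^bsub>B_alg\<^esub> fst x, c \<odot>\<^bsub>A\<^esub> snd x)"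
  "\<one>\<^bsub>pullback_alg A \<psi>\<^esub> = (\<one>\<^bsub>B_alg\<^esub>, \<one>\<^bsub>A\<^esub>)"
  "\<zero>\<^bsub>pullback_alg A \<psi>\<^esub> = (\<zero>\<^bsub>B_alg\<^esub>, \<zero>\<^bsub>A\<^esub>)"
  by (simp_all add: pullback_alg_def case_prod_beta)

text \<open>
  Everything needed of a single map into the quotient, so that it can be used for each of the two
  pullbacks in turn.
\<close>

locale Q_representation = unital_algebra A
  for A :: "('k::field, 'a) module" (structure) +
  fixes \<psi> :: "'a \<Rightarrow> 'k inf_mat set"
  assumes \<psi>_hom: "\<psi> \<in> unital_alg_hom A Q_alg"
begin

lemma \<psi>_ring_hom: "\<psi> \<in> ring_hom A Q_alg"
  using \<psi>_hom by (simp add: unital_alg_hom_def)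

lemmas \<psi>_laws [simp] = ring_hom_laws[OF ring_axioms ring_Q \<psi>_ring_hom]

lemma \<psi>_smult: "a \<in> carrier A \<Longrightarrow> \<psi> (c \<odot> a) = c \<odot>\<^bsub>Q_alg\<^esub> \<psi> a"
  using \<psi>_hom by (simp add: unital_alg_hom_def)

lemma lift_exists:
  assumes "a \<in> carrier A"
  obtains m where "m \<in> carrier B_alg" "Q_proj m = \<psi> a"
  using \<psi>_laws(1)[OF assms] unfolding Q_alg_carrier_eq by auto

lemma unital_algebra_pullback: "unital_algebra (pullback_alg A \<psi>)"
proof (rule unital_algebraI)
  have "abelian_group (pullback_alg A \<psi>)"
  proof (rule abelian_groupI)
    fix x assume "x \<in> carrier (pullback_alg A \<psi>)"
    then show "\<exists>y\<in>carrier (pullback_alg A \<psi>).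
        y \<oplus>\<^bsub>pullback_alg A \<psi>\<^esub> x = \<zero>\<^bsub>pullback_alg A \<psi>\<^esub>"
      by (intro bexI[of _ "(\<ominus>\<^bsub>B_alg\<^esub> fst x, \<ominus> snd x)"])
        (simp_all add: pullback_simps B.l_neg l_neg)
  qed (simp_all add: pullback_simps B.a_ac a_ac)
  moreover have "Group.monoid (pullback_alg A \<psi>)"
    by (rule monoidI) (simp_all add: pullback_simps B.m_assoc m_assoc)
  ultimately show "ring (pullback_alg A \<psi>)"
    by (rule ringI) (simp_all add: pullback_simps B.l_distr B.r_distr l_distr r_distr)
qed (simp_all add: pullback_simps Q_proj_smult \<psi>_smult B.scalar_laws scalar_laws
    B.smult_mult_left B.smult_mult_right smult_mult_left smult_mult_right)

text \<open>Over \<open>0\<close>, the fibre condition says that the class of the matrix part is zero.\<close>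

lemma pullback_incl_image:
  "pullback_incl A ` carrier M_inf = a_kernel (pullback_alg A \<psi>) A pullback_proj"
proof -
  have "(m, \<zero>) \<in> carrier (pullback_alg A \<psi>) \<longleftrightarrow> m \<in> carrier M_inf" for m
    using Q_proj_eq_zero_iff[of m] by (auto simp: pullback_simps M_inf_in_B)
  then show ?thesis
    by (force simp: a_kernel_def kernel_def pullback_incl_def pullback_proj_def)
qed

lemma pullback_extension:
  "extension A (pullback_alg A \<psi>) (pullback_incl A) pullback_proj"
  unfolding extension_def
proof (intro conjI)
  show "unital_algebra A" by (rule unital_algebra_axioms)
  show "pullback_incl A \<in> nonunital_alg_hom M_inf (pullback_alg A \<psi>)"
    by (auto simp: nonunital_alg_hom_def hom_def pullback_incl_def pullback_simps M_inf_simps(2-4)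
        M_inf_in_B Q_proj_eq_zero_iff smult_zero)
  show "pullback_proj \<in> unital_alg_hom (pullback_alg A \<psi>) A"
    by (auto simp: unital_alg_hom_def ring_hom_def pullback_proj_def pullback_simps)
  show "pullback_proj ` carrier (pullback_alg A \<psi>) = carrier A"
  proof
    show "carrier A \<subseteq> pullback_proj ` carrier (pullback_alg A \<psi>)"
    proof
      fix a assume a: "a \<in> carrier A"
      then obtain m where "m \<in> carrier B_alg" "Q_proj m = \<psi> a" by (rule lift_exists)
      with a have "(m, a) \<in> carrier (pullback_alg A \<psi>)" by (simp add: pullback_simps)
      then show "a \<in> pullback_proj ` carrier (pullback_alg A \<psi>)"
        by (force simp: pullback_proj_def)
    qed
  qed (auto simp: pullback_proj_def pullback_simps)
qed (simp_all add: unital_algebra_pullback pullback_incl_image, simp add: inj_on_def pullback_incl_def)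

lemma pullback_faithful_extension:
  assumes inj: "inj_on \<psi> (carrier A)"
  shows "faithful_extension A (pullback_alg A \<psi>) (pullback_incl A) pullback_proj"
  unfolding faithful_extension_def faithful_ideal_def
proof (intro conjI ballI impI)
  interpret E: unital_algebra "pullback_alg A \<psi>" by (rule unital_algebra_pullback)
  interpret p: ring_hom_ring "pullback_alg A \<psi>" A pullback_proj
    using pullback_extension
    by (intro ring_hom_ringI2 E.ring_axioms ring_axioms)
      (simp add: extension_def unital_alg_hom_def)
  show "ideal (pullback_incl A ` carrier M_inf) (pullback_alg A \<psi>)"
    unfolding pullback_incl_image by (rule p.kernel_is_ideal)
  \<comment> \<open>A pair with vanishing matrix part has vanishing algebra part, since \<open>\<psi>\<close> is injective.\<close>
  have zero: "x = \<zero>\<^bsub>pullback_alg A \<psi>\<^esub>"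
    if "x \<in> carrier (pullback_alg A \<psi>)" "fst x = \<zero>\<^bsub>B_alg\<^esub>" for x
  proof -
    have "\<psi> (snd x) = Q_proj (fst x)" using that(1) by (simp add: pullback_simps)
    also have "\<dots> = \<psi> \<zero>" by (simp add: that(2))
    finally have "\<psi> (snd x) = \<psi> \<zero>" .
    then have "snd x = \<zero>" using that(1) inj by (simp add: pullback_simps inj_on_def)
    with that(2) show ?thesis by (simp add: pullback_simps prod_eq_iff)
  qed
  fix x assume x: "x \<in> carrier (pullback_alg A \<psi>)"
  show "x = \<zero>\<^bsub>pullback_alg A \<psi>\<^esub>"
    if "\<forall>y\<in>pullback_incl A ` carrier M_inf.
      x \<otimes>\<^bsub>pullback_alg A \<psi>\<^esub> y = \<zero>\<^bsub>pullback_alg A \<psi>\<^esub>"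
  proof (rule zero[OF x], rule M_inf_annihilators(1))
    show "fst x \<in> carrier B_alg" using x by (simp add: pullback_simps)
    fix y :: "'k inf_mat" assume "y \<in> carrier M_inf"
    then have "x \<otimes>\<^bsub>pullback_alg A \<psi>\<^esub> pullback_incl A y = \<zero>\<^bsub>pullback_alg A \<psi>\<^esub>"
      using that by blast
    then show "fst x \<otimes>\<^bsub>B_alg\<^esub> y = \<zero>\<^bsub>B_alg\<^esub>"
      by (simp add: pullback_simps pullback_incl_def)
  qed
  show "x = \<zero>\<^bsub>pullback_alg A \<psi>\<^esub>"
    if "\<forall>y\<in>pullback_incl A ` carrier M_inf.
      y \<otimes>\<^bsub>pullback_alg A \<psi>\<^esub> x = \<zero>\<^bsub>pullback_alg A \<psi>\<^esub>"
  proof (rule zero[OF x], rule M_inf_annihilators(2))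
    show "fst x \<in> carrier B_alg" using x by (simp add: pullback_simps)
    fix y :: "'k inf_mat" assume "y \<in> carrier M_inf"
    then have "pullback_incl A y \<otimes>\<^bsub>pullback_alg A \<psi>\<^esub> x = \<zero>\<^bsub>pullback_alg A \<psi>\<^esub>"
      using that by blast
    then show "y \<otimes>\<^bsub>B_alg\<^esub> fst x = \<zero>\<^bsub>B_alg\<^esub>"
      by (simp add: pullback_simps pullback_incl_def)
  qed
qed (rule pullback_extension)

end

section \<open>Automorphisms of the finite matrices are inner\<close>

text \<open>
  A row of a product depends only on that row of the left factor, and a column only on that column
  of the right factor. This lets a matrix assembled from rows (or columns) of different matrices be multiplied
  one row (or column) at a time.
\<close>

lemma mult_row_cong:
  assumes "\<And>k. m i k = c * m' i' k"
  shows "(m \<otimes>\<^bsub>B_alg\<^esub> n) i j = c * (m' \<otimes>\<^bsub>B_alg\<^esub> n) i' j"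
  by (cases "c = 0") (simp_all add: B_mult assms sum_distrib_left mult.assoc)

lemma mult_column_cong:
  assumes "\<And>k. n k j = n' k j'"
  shows "(m \<otimes>\<^bsub>B_alg\<^esub> n) i j = (m \<otimes>\<^bsub>B_alg\<^esub> n') i j'"
  by (simp add: B_mult assms)

text \<open>
  Let \<open>f\<close> denote the images of the matrix units \<open>e\<close>, and choose an entry \<open>c = f 0 0 p q \<noteq> 0\<close>.
  The idempotent \<open>f 0 0\<close> has rank one, so its column \<open>q\<close> spans its column space and its row
  \<open>p\<close> its row space; moving these around by \<open>f j 0\<close> and \<open>f 0 i\<close> gives bases of the space of finite
  columns and of finite rows. Accordingly, column \<open>j\<close> of \<open>V\<close> is column \<open>q\<close> of \<open>f j 0\<close>, and row
  \<open>i\<close> of \<open>U\<close> is row \<open>p\<close> of \<open>f 0 i\<close> divided by \<open>c\<close>. With this choice the entries of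
  \<open>U * \<alpha> x * V\<close> are those of \<open>\<alpha> (e 0 i * x * e j 0) = x i j * f 0 0\<close> at \<open>(p, q)\<close> divided by
  \<open>c\<close>, whence \<open>U * \<alpha> x * V = x\<close> without decomposing \<open>x\<close> into matrix units.
  Surjectivity of \<open>\<alpha>\<close> is what makes the columns of \<open>U\<close> and the rows of \<open>V\<close> finite and
  \<open>V * U\<close>, not only \<open>U * V\<close>, the identity.
\<close>

lemma M_inf_automorphism_inner:
  fixes \<alpha> :: "'k::field inf_mat \<Rightarrow> 'k inf_mat"
  assumes hom: "\<alpha> \<in> nonunital_alg_hom M_inf M_inf"
    and bij: "bij_betw \<alpha> (carrier M_inf) (carrier M_inf)"
  obtains U where "U \<in> Units B_alg"
    and "\<And>x. x \<in> carrier M_inf \<Longrightarrow>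
      \<alpha> x = inv\<^bsub>B_alg\<^esub> U \<otimes>\<^bsub>B_alg\<^esub> x \<otimes>\<^bsub>B_alg\<^esub> U"
proof -
  note mult = ideal.I_l_closed[OF M_inf_ideal] ideal.I_r_closed[OF M_inf_ideal]
  have \<alpha>_mult: "\<alpha> (x \<otimes>\<^bsub>B_alg\<^esub> y) = \<alpha> x \<otimes>\<^bsub>B_alg\<^esub> \<alpha> y"
    if "x \<in> carrier M_inf" "y \<in> carrier M_inf" for x y
    using hom that by (auto simp: nonunital_alg_hom_def hom_def M_inf_simps(2))
  have \<alpha>_smult: "\<alpha> (c \<odot>\<^bsub>B_alg\<^esub> x) = c \<odot>\<^bsub>B_alg\<^esub> \<alpha> x" if "x \<in> carrier M_inf" for c x
    using hom that by (auto simp: nonunital_alg_hom_def M_inf_simps(4))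
  have \<alpha>_closed: "\<alpha> x \<in> carrier M_inf" if "x \<in> carrier M_inf" for x
    using bij that by (auto simp: bij_betw_def)
  have \<alpha>_surj: "\<exists>x\<in>carrier M_inf. \<alpha> x = y" if "y \<in> carrier M_inf" for y
    using bij that unfolding bij_betw_def by (metis imageE)
  have zero_smult: "0 \<odot>\<^bsub>B_alg\<^esub> x = \<zero>\<^bsub>B_alg\<^esub>" for x :: "'k inf_mat"
    by (simp add: fun_eq_iff B_alg_simps)
  have \<alpha>_zero: "\<alpha> \<zero>\<^bsub>B_alg\<^esub> = \<zero>\<^bsub>B_alg\<^esub>"
    using \<alpha>_smult[of "\<zero>\<^bsub>B_alg\<^esub>" 0] by (simp add: zero_smult M_inf_closed)
  note carr = M_inf_in_B M_inf_closed \<alpha>_closed mult B.m_closed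

  let ?e = "mat_unit :: nat \<Rightarrow> nat \<Rightarrow> 'k inf_mat"
  define f where "f i j = \<alpha> (?e i j)" for i j
  have f_closed: "f i j \<in> carrier M_inf" for i j
    by (simp add: f_def carr)
  have "f 0 0 \<noteq> \<zero>\<^bsub>B_alg\<^esub>"
  proof
    assume "f 0 0 = \<zero>\<^bsub>B_alg\<^esub>"
    then have "\<alpha> (?e 0 0) = \<alpha> \<zero>\<^bsub>B_alg\<^esub>" by (simp add: f_def \<alpha>_zero)
    then have "?e 0 0 = \<zero>\<^bsub>B_alg\<^esub>"
      by (rule inj_onD[OF bij_betw_imp_inj_on[OF bij]]) (rule M_inf_closed)+
    then have "?e 0 0 0 0 = \<zero>\<^bsub>B_alg\<^esub> 0 0" by simp
    then show False by (simp add: B_alg_simps mat_unit_def)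
  qed
  then obtain p q where c: "f 0 0 p q \<noteq> 0"
    by (auto simp: fun_eq_iff B_alg_simps)
  define U where "U i l = inverse (f 0 0 p q) * f 0 i p l" for i l
  define V where "V k j = f j 0 k q" for k j

  have U_row: "(U \<otimes>\<^bsub>B_alg\<^esub> x) i j = inverse (f 0 0 p q) * (f 0 i \<otimes>\<^bsub>B_alg\<^esub> x) p j" for x i j
    by (rule mult_row_cong) (simp add: U_def)
  have V_column: "(x \<otimes>\<^bsub>B_alg\<^esub> V) i j = (x \<otimes>\<^bsub>B_alg\<^esub> f j 0) i q" for x i j
    by (rule mult_column_cong) (simp add: V_def)

  have U: "U \<in> carrier B_alg"
    unfolding B_alg_simps(1)
  proof (intro conjI allI)
    fix i
    show "finite {j. U i j \<noteq> 0}"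
      using M_inf_in_B[OF f_closed[of 0 i]] c by (simp add: U_def B_alg_simps)
  next
    fix l
    obtain y where y: "y \<in> carrier M_inf" "\<alpha> y = ?e l l"
      using \<alpha>_surj M_inf_closed(3) by blast
    \<comment> \<open>The column \<open>l\<close> of \<open>f 0 i\<close> is that of \<open>\<alpha> (e 0 i * y)\<close>, which vanishes if row \<open>i\<close>
      of the finite matrix \<open>y\<close> does.\<close>
    have "i \<in> fst ` {(i, j). y i j \<noteq> 0}" if "U i l \<noteq> 0" for i
    proof -
      have "f 0 i p l = (f 0 i \<otimes>\<^bsub>B_alg\<^esub> ?e l l) p l"
        by (simp add: mult_mat_unit M_inf_in_B f_closed)
      also have "\<dots> = \<alpha> (?e 0 i \<otimes>\<^bsub>B_alg\<^esub> y) p l"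
        by (simp add: f_def y(1) \<alpha>_mult carr flip: y(2))
      finally have "?e 0 i \<otimes>\<^bsub>B_alg\<^esub> y \<noteq> \<zero>\<^bsub>B_alg\<^esub>"
        using that c by (auto simp: U_def \<alpha>_zero B_alg_simps)
      then obtain j where "y i j \<noteq> 0"
        by (auto simp: fun_eq_iff mat_unit_mult B_alg_simps split: if_splits)
      then show ?thesis by force
    qed
    then have "{i. U i l \<noteq> 0} \<subseteq> fst ` {(i, j). y i j \<noteq> 0}" by blast
    then show "finite {i. U i l \<noteq> 0}"
      by (rule finite_subset) (use y in \<open>simp add: M_inf_simps\<close>)
  qed
  have V: "V \<in> carrier B_alg"
    unfolding B_alg_simps(1)
  proof (intro conjI allI)
    fix j
    show "finite {i. V i j \<noteq> 0}"
      using M_inf_in_B[OF f_closed[of j 0]] by (simp add: V_def B_alg_simps)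
  next
    fix k
    obtain y where y: "y \<in> carrier M_inf" "\<alpha> y = ?e k k"
      using \<alpha>_surj M_inf_closed(3) by blast
    have "j \<in> snd ` {(i, j). y i j \<noteq> 0}" if "V k j \<noteq> 0" for j
    proof -
      have "f j 0 k q = (?e k k \<otimes>\<^bsub>B_alg\<^esub> f j 0) k q"
        by (simp add: mat_unit_mult)
      also have "\<dots> = \<alpha> (y \<otimes>\<^bsub>B_alg\<^esub> ?e j 0) k q"
        by (simp add: f_def y(1) \<alpha>_mult carr flip: y(2))
      finally have "y \<otimes>\<^bsub>B_alg\<^esub> ?e j 0 \<noteq> \<zero>\<^bsub>B_alg\<^esub>"
        using that by (auto simp: V_def \<alpha>_zero B_alg_simps)
      then obtain i where "y i j \<noteq> 0"
        using M_inf_in_B[OF y(1)] by (auto simp: fun_eq_iff mult_mat_unit B_alg_simps(4) split: if_splits)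
      then show ?thesis by force
    qed
    then have "{j. V k j \<noteq> 0} \<subseteq> snd ` {(i, j). y i j \<noteq> 0}" by blast
    then show "finite {j. V k j \<noteq> 0}"
      by (rule finite_subset) (use y in \<open>simp add: M_inf_simps\<close>)
  qed
  note assoc = B.m_assoc U V M_inf_in_B \<alpha>_closed mult

  have U_\<alpha>_V: "U \<otimes>\<^bsub>B_alg\<^esub> \<alpha> x \<otimes>\<^bsub>B_alg\<^esub> V = x" if x: "x \<in> carrier M_inf" for x
  proof (intro ext)
    fix i j
    have "?e 0 i \<otimes>\<^bsub>B_alg\<^esub> x \<otimes>\<^bsub>B_alg\<^esub> ?e j 0 = x i j \<odot>\<^bsub>B_alg\<^esub> ?e 0 0"
      using x by (auto simp: fun_eq_iff mult_mat_unit mat_unit_mult B_alg_simps(3) carr)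
        (simp_all add: mat_unit_def)
    then have "f 0 i \<otimes>\<^bsub>B_alg\<^esub> \<alpha> x \<otimes>\<^bsub>B_alg\<^esub> f j 0 = x i j \<odot>\<^bsub>B_alg\<^esub> f 0 0"
      using x by (simp add: f_def carr flip: \<alpha>_mult \<alpha>_smult)
    moreover have "(U \<otimes>\<^bsub>B_alg\<^esub> \<alpha> x \<otimes>\<^bsub>B_alg\<^esub> V) i j =
        inverse (f 0 0 p q) * (f 0 i \<otimes>\<^bsub>B_alg\<^esub> \<alpha> x \<otimes>\<^bsub>B_alg\<^esub> f j 0) p q"
      unfolding V_column by (rule mult_row_cong) (rule U_row)
    ultimately show "(U \<otimes>\<^bsub>B_alg\<^esub> \<alpha> x \<otimes>\<^bsub>B_alg\<^esub> V) i j = x i j"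
      using c by (simp add: B_alg_simps)
  qed
  have UV: "U \<otimes>\<^bsub>B_alg\<^esub> V = \<one>\<^bsub>B_alg\<^esub>"
  proof (intro ext)
    fix i j
    have "f 0 i \<otimes>\<^bsub>B_alg\<^esub> f j 0 = (if i = j then f 0 0 else \<zero>\<^bsub>B_alg\<^esub>)"
      by (simp add: f_def carr mat_unit_mat_unit \<alpha>_zero flip: \<alpha>_mult)
    then show "(U \<otimes>\<^bsub>B_alg\<^esub> V) i j = \<one>\<^bsub>B_alg\<^esub> i j"
      using c by (simp add: V_column U_row B_alg_simps)
  qed
  \<comment> \<open>Elements of the ideal are determined by their compression by \<open>U\<close> and \<open>V\<close>, since
    they are of the form \<open>\<alpha> x\<close>; multiplying by \<open>V * U\<close> does not change the compression.\<close>
  have VU_left: "V \<otimes>\<^bsub>B_alg\<^esub> U \<otimes>\<^bsub>B_alg\<^esub> z = z" if z: "z \<in> carrier M_inf" for z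
  proof -
    let ?w = "V \<otimes>\<^bsub>B_alg\<^esub> U \<otimes>\<^bsub>B_alg\<^esub> z"
    have w: "?w \<in> carrier M_inf" using z U V by (simp add: mult)
    obtain x y where x: "x \<in> carrier M_inf" "\<alpha> x = ?w" and y: "y \<in> carrier M_inf" "\<alpha> y = z"
      using \<alpha>_surj w z by meson
    have "U \<otimes>\<^bsub>B_alg\<^esub> ?w = (U \<otimes>\<^bsub>B_alg\<^esub> V) \<otimes>\<^bsub>B_alg\<^esub> (U \<otimes>\<^bsub>B_alg\<^esub> z)"
      using z U V by (simp add: B.m_assoc M_inf_in_B)
    also have "\<dots> = U \<otimes>\<^bsub>B_alg\<^esub> z"
      using z U by (simp add: UV M_inf_in_B)
    finally have "x = y"
      using U_\<alpha>_V[OF x(1)] U_\<alpha>_V[OF y(1)] by (simp add: x y)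
    then show ?thesis using x y by simp
  qed
  have VU: "V \<otimes>\<^bsub>B_alg\<^esub> U = \<one>\<^bsub>B_alg\<^esub>"
    by (rule eq_if_mult_mat_units_eq) (use U V in \<open>simp_all add: VU_left M_inf_closed mat_unit_in_B\<close>)
  have "U \<in> Units B_alg"
    using U V UV VU unfolding Units_def by blast
  moreover have inv: "V = inv\<^bsub>B_alg\<^esub> U"
    using U V UV VU by (intro B.inv_unique')
  moreover have "\<alpha> x = V \<otimes>\<^bsub>B_alg\<^esub> x \<otimes>\<^bsub>B_alg\<^esub> U" if x: "x \<in> carrier M_inf" for x
  proof -
    have \<alpha>x: "\<alpha> x \<in> carrier B_alg" using x by (simp add: carr)
    have "V \<otimes>\<^bsub>B_alg\<^esub> x \<otimes>\<^bsub>B_alg\<^esub> U = V \<otimes>\<^bsub>B_alg\<^esub> (U \<otimes>\<^bsub>B_alg\<^esub> \<alpha> x \<otimes>\<^bsub>B_alg\<^esub> V) \<otimes>\<^bsub>B_alg\<^esub> U"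
      by (simp only: U_\<alpha>_V[OF x])
    also have "\<dots> = (V \<otimes>\<^bsub>B_alg\<^esub> U) \<otimes>\<^bsub>B_alg\<^esub> \<alpha> x \<otimes>\<^bsub>B_alg\<^esub> (V \<otimes>\<^bsub>B_alg\<^esub> U)"
      using U V \<alpha>x by (simp add: B.m_assoc)
    finally show ?thesis using \<alpha>x by (simp add: VU)
  qed
  ultimately show thesis using that by simp
qed


section \<open>Equivalence and conjugacy\<close>

lemma (in monoid) conjugate_cancel:
  assumes "u \<in> Units G" "x \<in> carrier G"
  shows "u \<otimes> (inv u \<otimes> x \<otimes> u) \<otimes> inv u = x"
proof -
  have "u \<otimes> (inv u \<otimes> x \<otimes> u) \<otimes> inv u = (u \<otimes> inv u) \<otimes> x \<otimes> (u \<otimes> inv u)"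
    using assms by (simp add: m_assoc Units_closed del: Units_r_inv)
  then show ?thesis using assms by simp
qed

lemma (in monoid) conjugate_mult:
  assumes "u \<in> Units G" "x \<in> carrier G" "y \<in> carrier G"
  shows "inv u \<otimes> (x \<otimes> y) \<otimes> u = (inv u \<otimes> x \<otimes> u) \<otimes> (inv u \<otimes> y \<otimes> u)"
proof -
  have "(inv u \<otimes> x \<otimes> u) \<otimes> (inv u \<otimes> y \<otimes> u) = inv u \<otimes> x \<otimes> (u \<otimes> inv u) \<otimes> y \<otimes> u"
    using assms by (simp add: m_assoc Units_closed del: Units_r_inv)
  then show ?thesis using assms by (simp add: m_assoc Units_closed)
qed

text \<open>
  The pullbacks share the fibres over \<open>a\<close> up to conjugation by \<open>U\<close>, so conjugating the matrix
  part is an isomorphism between them, and conjugation preserves the ideal of finite matrices.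
\<close>

lemma conjugate_imp_equivalent:
  fixes A :: "('k::field, 'a) module"
  assumes U: "U \<in> Units B_alg"
    and "Q_representation A \<psi>\<^sub>1"
    and conj: "\<And>a. a \<in> carrier A \<Longrightarrow>
      \<psi>\<^sub>2 a = inv\<^bsub>Q_alg\<^esub> (Q_proj U) \<otimes>\<^bsub>Q_alg\<^esub> \<psi>\<^sub>1 a \<otimes>\<^bsub>Q_alg\<^esub> Q_proj U"
  shows "equivalent_extensions
    (pullback_alg A \<psi>\<^sub>1) (pullback_incl A) pullback_proj
    (pullback_alg A \<psi>\<^sub>2) (pullback_incl A) pullback_proj"
proof -
  interpret Q_representation A \<psi>\<^sub>1 by fact
  let ?V = "inv\<^bsub>B_alg\<^esub> U"
  define \<gamma> where "\<gamma> m = ?V \<otimes>\<^bsub>B_alg\<^esub> m \<otimes>\<^bsub>B_alg\<^esub> U" for m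
  define \<delta> where "\<delta> m = U \<otimes>\<^bsub>B_alg\<^esub> m \<otimes>\<^bsub>B_alg\<^esub> ?V" for m
  have U': "U \<in> carrier B_alg" and V: "?V \<in> Units B_alg" "?V \<in> carrier B_alg"
    using U by auto
  note mult = ideal.I_l_closed[OF M_inf_ideal] ideal.I_r_closed[OF M_inf_ideal]
  have closed: "\<gamma> m \<in> carrier B_alg" "\<delta> m \<in> carrier B_alg" if "m \<in> carrier B_alg" for m
    using that U' V by (simp_all add: \<gamma>_def \<delta>_def)
  have closed_inf: "\<gamma> m \<in> carrier M_inf" "\<delta> m \<in> carrier M_inf" if "m \<in> carrier M_inf" for m
    using that U' V by (simp_all add: \<gamma>_def \<delta>_def mult)
  have \<delta>_\<gamma>: "\<delta> (\<gamma> m) = m" and \<gamma>_\<delta>: "\<gamma> (\<delta> m) = m" if "m \<in> carrier B_alg" for m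
    using B.conjugate_cancel[OF U that] B.conjugate_cancel[OF V(1) that] U
    by (simp_all add: \<gamma>_def \<delta>_def)
  have \<gamma>_mult: "\<gamma> (m \<otimes>\<^bsub>B_alg\<^esub> n) = \<gamma> m \<otimes>\<^bsub>B_alg\<^esub> \<gamma> n"
    if "m \<in> carrier B_alg" "n \<in> carrier B_alg" for m n
    using that U by (simp add: \<gamma>_def B.conjugate_mult)
  have \<gamma>_add: "\<gamma> (m \<oplus>\<^bsub>B_alg\<^esub> n) = \<gamma> m \<oplus>\<^bsub>B_alg\<^esub> \<gamma> n"
    if "m \<in> carrier B_alg" "n \<in> carrier B_alg" for m n
    using that U' V by (simp add: \<gamma>_def B.l_distr B.r_distr)
  have \<gamma>_smult: "\<gamma> (c \<odot>\<^bsub>B_alg\<^esub> m) = c \<odot>\<^bsub>B_alg\<^esub> \<gamma> m" if "m \<in> carrier B_alg" for c m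
    using that U' V by (simp add: \<gamma>_def B.smult_mult_left B.smult_mult_right)
  have \<gamma>_one: "\<gamma> \<one>\<^bsub>B_alg\<^esub> = \<one>\<^bsub>B_alg\<^esub>"
    using U V by (simp add: \<gamma>_def)
  have \<gamma>_fibre: "Q_proj (\<gamma> m) = \<psi>\<^sub>2 a" if "m \<in> carrier B_alg" "a \<in> carrier A" "Q_proj m = \<psi>\<^sub>1 a" for m a
    using that Q_proj_conjugate(3)[OF U that(1)] by (simp add: \<gamma>_def conj)
  have \<delta>_fibre: "Q_proj (\<delta> m) = \<psi>\<^sub>1 a" if "m \<in> carrier B_alg" "a \<in> carrier A" "Q_proj m = \<psi>\<^sub>2 a" for m a
  proof -
    have "Q_proj (\<delta> m) = Q_proj U \<otimes>\<^bsub>Q_alg\<^esub> \<psi>\<^sub>2 a \<otimes>\<^bsub>Q_alg\<^esub> inv\<^bsub>Q_alg\<^esub> Q_proj U"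
      using that U' V Q_proj_conjugate(2)[OF U that(1)] by (simp add: \<delta>_def)
    then show ?thesis
      using that Q.conjugate_cancel[OF Q_proj_conjugate(1)[OF U that(1)], of "\<psi>\<^sub>1 a"] by (simp add: conj)
  qed
  define \<Phi> where "\<Phi> = map_prod \<gamma> (\<lambda>a :: 'a. a)"
  have "\<Phi> \<in> unital_alg_hom (pullback_alg A \<psi>\<^sub>1) (pullback_alg A \<psi>\<^sub>2)"
    by (auto simp: unital_alg_hom_def ring_hom_def \<Phi>_def pullback_simps closed
        \<gamma>_mult \<gamma>_add \<gamma>_smult \<gamma>_one \<gamma>_fibre)
  moreover have "bij_betw \<Phi> (carrier (pullback_alg A \<psi>\<^sub>1)) (carrier (pullback_alg A \<psi>\<^sub>2))"
    by (rule bij_betw_byWitness[where f' = "map_prod \<delta> (\<lambda>a. a)"])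
      (auto simp: \<Phi>_def pullback_simps closed \<gamma>_fibre \<delta>_fibre \<delta>_\<gamma> \<gamma>_\<delta>)
  moreover have "\<gamma> \<in> nonunital_alg_hom M_inf M_inf"
    by (auto simp: nonunital_alg_hom_def hom_def M_inf_simps(2-4) M_inf_in_B closed_inf
        \<gamma>_mult \<gamma>_add \<gamma>_smult)
  moreover have "bij_betw \<gamma> (carrier M_inf) (carrier M_inf)"
    by (rule bij_betw_byWitness[where f' = \<delta>]) (auto simp: closed_inf \<delta>_\<gamma> \<gamma>_\<delta> M_inf_in_B)
  ultimately show ?thesis
    unfolding equivalent_extensions_def
    by (intro bexI[of _ \<Phi>] bexI[of _ \<gamma>] conjI)
      (simp_all add: \<Phi>_def pullback_incl_def pullback_proj_def)
qed

text \<open>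
  On the ideal an equivalence is conjugation by some \<open>U\<close>. This forces the same on all of the
  extension: multiplying by elements of the ideal, which is faithful, recovers the matrix part
  of the image of a pair, so \<open>(m, a)\<close> has to go to \<open>(inv U * m * U, a)\<close>. Membership of
  this pair in the second pullback is the asserted formula for \<open>\<psi>\<^sub>2 a\<close>.
\<close>

lemma equivalent_imp_conjugate:
  fixes A :: "('k::field, 'a) module" (structure)
  assumes "Q_representation A \<psi>\<^sub>1"
    and equiv: "equivalent_extensions
      (pullback_alg A \<psi>\<^sub>1) (pullback_incl A) pullback_proj
      (pullback_alg A \<psi>\<^sub>2) (pullback_incl A) pullback_proj"
  obtains U where "U \<in> Units B_alg"
    and "\<And>a. a \<in> carrier A \<Longrightarrow>
      \<psi>\<^sub>2 a = inv\<^bsub>Q_alg\<^esub> (Q_proj U) \<otimes>\<^bsub>Q_alg\<^esub> \<psi>\<^sub>1 a \<otimes>\<^bsub>Q_alg\<^esub> Q_proj U"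
proof -
  interpret Q_representation A \<psi>\<^sub>1 by fact
  from equiv obtain \<Phi> \<alpha> where
    \<Phi>: "\<Phi> \<in> unital_alg_hom (pullback_alg A \<psi>\<^sub>1) (pullback_alg A \<psi>\<^sub>2)"
    and \<alpha>: "\<alpha> \<in> nonunital_alg_hom M_inf M_inf" "bij_betw \<alpha> (carrier M_inf) (carrier M_inf)"
    and \<Phi>_incl: "\<And>m. m \<in> carrier M_inf \<Longrightarrow> \<Phi> (m, \<zero>) = (\<alpha> m, \<zero>)"
    and \<Phi>_proj: "\<And>x. x \<in> carrier (pullback_alg A \<psi>\<^sub>1) \<Longrightarrow> snd (\<Phi> x) = snd x"
    unfolding equivalent_extensions_def pullback_incl_def pullback_proj_def by blast
  obtain U where U: "U \<in> Units B_alg"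
    and \<alpha>_eq: "\<And>x. x \<in> carrier M_inf \<Longrightarrow>
      \<alpha> x = inv\<^bsub>B_alg\<^esub> U \<otimes>\<^bsub>B_alg\<^esub> x \<otimes>\<^bsub>B_alg\<^esub> U"
    using M_inf_automorphism_inner[OF \<alpha>] by blast
  let ?V = "inv\<^bsub>B_alg\<^esub> U"
  have U': "U \<in> carrier B_alg" and V: "?V \<in> carrier B_alg"
    using U by auto
  have "\<psi>\<^sub>2 a = inv\<^bsub>Q_alg\<^esub> (Q_proj U) \<otimes>\<^bsub>Q_alg\<^esub> \<psi>\<^sub>1 a \<otimes>\<^bsub>Q_alg\<^esub> Q_proj U"
    if a: "a \<in> carrier A" for a
  proof -
    obtain m where m: "m \<in> carrier B_alg" "Q_proj m = \<psi>\<^sub>1 a"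
      using a by (rule lift_exists)
    with a have ma: "(m, a) \<in> carrier (pullback_alg A \<psi>\<^sub>1)" by (simp add: pullback_simps)
    define n where "n = fst (\<Phi> (m, a))"
    have \<Phi>_ma: "\<Phi> (m, a) = (n, a)"
      using \<Phi>_proj[OF ma] by (simp add: n_def prod_eq_iff)
    moreover have "\<Phi> (m, a) \<in> carrier (pullback_alg A \<psi>\<^sub>2)"
      using \<Phi> ma by (auto simp: unital_alg_hom_def ring_hom_closed)
    ultimately have n: "n \<in> carrier B_alg" "Q_proj n = \<psi>\<^sub>2 a"
      by (simp_all add: pullback_simps)
    \<comment> \<open>Both sides agree after multiplication by elements of the ideal, because \<open>\<Phi>\<close> is
      multiplicative and restricts to conjugation there.\<close>
    have "n \<otimes>\<^bsub>B_alg\<^esub> ?V = ?V \<otimes>\<^bsub>B_alg\<^esub> m"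
    proof (rule eq_if_mult_mat_units_eq)
      fix k
      let ?x = "mat_unit k k :: 'k inf_mat"
      have x: "?x \<in> carrier M_inf" "?x \<in> carrier B_alg"
        by (rule M_inf_closed mat_unit_in_B)+
      have mx: "m \<otimes>\<^bsub>B_alg\<^esub> ?x \<in> carrier M_inf"
        using m x by (simp add: ideal.I_l_closed[OF M_inf_ideal])
      have "(?x, \<zero>) \<in> carrier (pullback_alg A \<psi>\<^sub>1)"
        using x by (simp add: pullback_simps Q_proj_eq_zero_iff)
      with \<Phi> ma have "\<Phi> ((m, a) \<otimes>\<^bsub>pullback_alg A \<psi>\<^sub>1\<^esub> (?x, \<zero>)) =
          \<Phi> (m, a) \<otimes>\<^bsub>pullback_alg A \<psi>\<^sub>2\<^esub> \<Phi> (?x, \<zero>)"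
        unfolding unital_alg_hom_def by (blast intro: ring_hom_mult)
      then have "\<alpha> (m \<otimes>\<^bsub>B_alg\<^esub> ?x) = n \<otimes>\<^bsub>B_alg\<^esub> \<alpha> ?x"
        using a x mx by (simp add: \<Phi>_ma \<Phi>_incl pullback_simps)
      then have "(n \<otimes>\<^bsub>B_alg\<^esub> ?V \<otimes>\<^bsub>B_alg\<^esub> ?x) \<otimes>\<^bsub>B_alg\<^esub> U =
          (?V \<otimes>\<^bsub>B_alg\<^esub> m \<otimes>\<^bsub>B_alg\<^esub> ?x) \<otimes>\<^bsub>B_alg\<^esub> U"
        using m n x mx U' V by (simp add: \<alpha>_eq B.m_assoc)
      then have "(n \<otimes>\<^bsub>B_alg\<^esub> ?V \<otimes>\<^bsub>B_alg\<^esub> ?x) \<otimes>\<^bsub>B_alg\<^esub> U \<otimes>\<^bsub>B_alg\<^esub> ?V =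
          (?V \<otimes>\<^bsub>B_alg\<^esub> m \<otimes>\<^bsub>B_alg\<^esub> ?x) \<otimes>\<^bsub>B_alg\<^esub> U \<otimes>\<^bsub>B_alg\<^esub> ?V"
        by simp
      then show "n \<otimes>\<^bsub>B_alg\<^esub> ?V \<otimes>\<^bsub>B_alg\<^esub> ?x = ?V \<otimes>\<^bsub>B_alg\<^esub> m \<otimes>\<^bsub>B_alg\<^esub> ?x"
        using m n x U U' V by (simp add: B.m_assoc)
    qed (use m n V in simp_all)
    then have "n \<otimes>\<^bsub>B_alg\<^esub> ?V \<otimes>\<^bsub>B_alg\<^esub> U = ?V \<otimes>\<^bsub>B_alg\<^esub> m \<otimes>\<^bsub>B_alg\<^esub> U" by simp
    then have "n = ?V \<otimes>\<^bsub>B_alg\<^esub> m \<otimes>\<^bsub>B_alg\<^esub> U"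
      using n U U' V by (simp add: B.m_assoc)
    then show ?thesis
      using Q_proj_conjugate(3)[OF U m(1)] m n by simp
  qed
  with U show thesis by (rule that)
qed

theorem theorem4p7:
  fixes A :: "('k::field_char_0, 'a) module"
    and \<psi>\<^sub>1 \<psi>\<^sub>2 :: "'a \<Rightarrow> 'k inf_mat set"
  assumes "unital_algebra A"
    and "\<psi>\<^sub>1 \<in> unital_alg_hom A Q_alg" and "inj_on \<psi>\<^sub>1 (carrier A)"
    and "\<psi>\<^sub>2 \<in> unital_alg_hom A Q_alg" and "inj_on \<psi>\<^sub>2 (carrier A)"
  shows "faithful_extension A (pullback_alg A \<psi>\<^sub>1) (pullback_incl A) pullback_proj \<and>
    faithful_extension A (pullback_alg A \<psi>\<^sub>2) (pullback_incl A) pullback_proj \<and>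
    (equivalent_extensions
        (pullback_alg A \<psi>\<^sub>1) (pullback_incl A) pullback_proj
        (pullback_alg A \<psi>\<^sub>2) (pullback_incl A) pullback_proj \<longleftrightarrow>
      (\<exists>U \<in> Units B_alg. \<forall>a \<in> carrier A.
         \<psi>\<^sub>2 a = inv\<^bsub>Q_alg\<^esub> (Q_proj U) \<otimes>\<^bsub>Q_alg\<^esub> \<psi>\<^sub>1 a \<otimes>\<^bsub>Q_alg\<^esub> Q_proj U))"
proof -
  have 1: "Q_representation A \<psi>\<^sub>1" and 2: "Q_representation A \<psi>\<^sub>2"
    using assms by (simp_all add: Q_representation_def Q_representation_axioms_def)
  show ?thesis
  proof (intro conjI iffI)
    assume "equivalent_extensions
      (pullback_alg A \<psi>\<^sub>1) (pullback_incl A) pullback_proj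
      (pullback_alg A \<psi>\<^sub>2) (pullback_incl A) pullback_proj"
    then show "\<exists>U \<in> Units B_alg. \<forall>a \<in> carrier A.
        \<psi>\<^sub>2 a = inv\<^bsub>Q_alg\<^esub> (Q_proj U) \<otimes>\<^bsub>Q_alg\<^esub> \<psi>\<^sub>1 a \<otimes>\<^bsub>Q_alg\<^esub> Q_proj U"
      by (rule equivalent_imp_conjugate[OF 1]) blast
  next
    assume "\<exists>U \<in> Units B_alg. \<forall>a \<in> carrier A.
        \<psi>\<^sub>2 a = inv\<^bsub>Q_alg\<^esub> (Q_proj U) \<otimes>\<^bsub>Q_alg\<^esub> \<psi>\<^sub>1 a \<otimes>\<^bsub>Q_alg\<^esub> Q_proj U"
    then obtain U where "U \<in> Units B_alg" "\<And>a. a \<in> carrier A \<Longrightarrow>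
        \<psi>\<^sub>2 a = inv\<^bsub>Q_alg\<^esub> (Q_proj U) \<otimes>\<^bsub>Q_alg\<^esub> \<psi>\<^sub>1 a \<otimes>\<^bsub>Q_alg\<^esub> Q_proj U"
      by blast
    then show "equivalent_extensions
      (pullback_alg A \<psi>\<^sub>1) (pullback_incl A) pullback_proj
      (pullback_alg A \<psi>\<^sub>2) (pullback_incl A) pullback_proj"
      by (rule conjugate_imp_equivalent[OF _ 1])
  qed (rule Q_representation.pullback_faithful_extension[OF 1 assms(3)]
      Q_representation.pullback_faithful_extension[OF 2 assms(5)])+
qed

end
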